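(* Let $\mathrm{G}$ be an undirected weighted loopless graph on nodes $\{1,\dots,N\}$ with positive edge weights and symmetric weighted adjacency matrix $\mathbf{W}$, let $\sigma\in\mathbb{R}$, and let $\tilde{\mathbf{L}}_{\mathrm{G}}$ be its symmetrically normalized Laplacian. Let $\mathbf{U}=[u_{i,j}]_{i,j=1}^{N}$ with $u_{i,j}=\frac{\sigma^{2}}{\sigma^{2}+1}\frac{\mathbf{W}(i,j)}{\sqrt{\mathrm{deg}_{\mathbf{W}}(i)\,\mathrm{deg}_{\mathbf{W}}(j)}}$ if $(i,j)$ is an edge of $\mathrm{G}$ and $u_{i,j}=0$ otherwise. Let $m\ge 1$ be an integer, $p_{\mathrm{term}}\in(0,1)$, and let $\mathrm{sample}$ be a non-degenerate sampling strategy on $\mathrm{G}_{\mathbf{U}}$. Let $\mathbf{C}\in\mathbb{R}^{N\times N}$ be the random matrix whose $i$-th row is $\frac{1}{\sigma^{2}+1}\phi(i)^{\top}$ for $i=1,\dots,N$, where $\phi(i)\in\mathbb{R}^{N}$ is the signature vector of node $i$ computed on $\mathrm{G}_{\mathbf{U}}$ by the random-walk procedure described in the context, let $\mathbf{C}'$ be an independent copy of $\mathbf{C}$, and define $\mathbf{D}=(\mathbf{I}_{N}+\sigma^{2}\tilde{\mathbf{L}}_{\mathrm{G}})\mathbf{C}'\in\mathbb{R}^{N\times N}$. Then the kernel matrix of the $1$-regularized Laplacian kernel of $\mathrm{G}$ satisfies $$(\mathbf{I}_{N}+\sigma^{2}\tilde{\mathbf{L}}_{\mathrm{G}})^{-1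}=\mathbb{E}\left[\mathbf{C}\mathbf{D}^{\top}\right].$$
   Context: Degrees: $\mathrm{deg}_{\mathbf{W}}(i)=\sum_{j}\mathbf{W}(i,j)$, the sum being over the neighbors $j$ of $i$ in $\mathrm{G}$. The symmetrically normalized Laplacian $\tilde{\mathbf{L}}_{\mathrm{G}}\in\mathbb{R}^{N\times N}$ has $\tilde{\mathbf{L}}_{\mathrm{G}}(v,v)=1$, $\tilde{\mathbf{L}}_{\mathrm{G}}(v,w)=-\frac{\mathbf{W}(v,w)}{\sqrt{\mathrm{deg}_{\mathbf{W}}(v)\mathrm{deg}_{\mathbf{W}}(w)}}$ if $(v,w)$ is an edge, and all other entries $0$. The $d$-regularized Laplacian kernel of $\mathrm{G}$ is the kernel on nodes with kernel matrix $(\mathbf{I}_{N}+\sigma^{2}\tilde{\mathbf{L}}_{\mathrm{G}})^{-d}$. $\mathrm{G}_{\mathbf{U}}$ is the weighted graph on vertex set $\{1,\dots,N\}$ with weighted adjacency matrix $\mathbf{U}$: the neighbors of $v$ are the $w$ with $u_{v,w}>0$, and $u_{v,w}$ is the weight of the edge $(v,w)$. Sampling strategy: $\mathrm{sample}(v,\mathrm{G}_{\mathbf{U}},\mathcal{H})$ takes the current vertex $v$, the graph, and a history $\mathcal{H}$ (some function of the list of edges traversed so far during the current run of the procedure, over all its walks). Conditionally on everything that has happened before, it draws a random neighbor $w$ of $v$ from a probability distribution on the neighbors of $v$ determined by $v$, $\mathrm{G}_{\mathbf{U}}$ and $\mathcal{H}$, and returns $w$ together with the probability $p$ with which this $w$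 was drawn. It is non-degenerate if it always assigns a positive probability to every neighbor $w$ of $v$. Procedure computing the signature vector $\phi(i)$, for a fixed node $i$: 1. Set $\phi(i)[j]=0$ for $j=1,\dots,N$, and $\mathcal{H}=\emptyset$. 2. For $t=1,\dots,m$ (the $t$-th random walk): set $\mathrm{load}=1$, set the current vertex to $i$, and add $1$ to $\phi(i)[i]$. Then repeat the following until the walk terminates. Before each transition, the walk terminates with probability $p_{\mathrm{term}}$, independently of everything else (it also terminates if the current vertex has no neighbors). If it does not terminate, let $v$ be the current vertex; obtain $(w,p)=\mathrm{sample}(v,\mathrm{G}_{\mathbf{U}},\mathcal{H})$; move to $w$; replace $\mathrm{load}$ by $\mathrm{load}\cdot\dfrac{u_{v,w}}{p\,(1-p_{\mathrm{term}})}$; add the new $\mathrm{load}$ to $\phi(i)[w]$; add the edge $(v,w)$ to $\mathcal{H}$. 3. Replace $\phi(i)$ by $\phi(i)/m$ and return it. The computations of $\phi(i)$ for different $i$ are carried out independently. $\mathbf{I}_N$ is the identity matrix. *)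

theory Defs
  imports "HOL-Probability.Probability" "HOL-Probability.SPMF"
begin

text \<open>A weighted graph on the finite type \<^typ>\<open>'n\<close> is given by its weighted adjacency matrix;
  \<open>(v, w)\<close> is an edge iff the entry at \<open>(v, w)\<close> is positive.\<close>

definition weighted_graph :: "real^'n^'n \<Rightarrow> bool" where
  "weighted_graph W \<longleftrightarrow>
     (\<forall>v w. W $ v $ w \<ge> 0) \<and> (\<forall>v w. W $ v $ w = W $ w $ v) \<and> (\<forall>v. W $ v $ v = 0)"

definition neighbors :: "real^'n^'n \<Rightarrow> 'n \<Rightarrow> 'n set" where
  "neighbors W v = {w. W $ v $ w > 0}"

definition deg :: "real^'n^'n \<Rightarrow> 'n \<Rightarrow> real" where
  "deg W v = (\<Sum>w\<in>neighbors W v. W $ v $ w)"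

definition norm_laplacian :: "real^'n^'n \<Rightarrow> real^'n^'n" where
  "norm_laplacian W = (\<chi> v w.
     if v = w then 1
     else if w \<in> neighbors W v then - (W $ v $ w / sqrt (deg W v * deg W w))
     else 0)"

definition shifted_laplacian :: "real \<Rightarrow> real^'n^'n \<Rightarrow> real^'n^'n" where
  "shifted_laplacian \<sigma> W = mat 1 + \<sigma>\<^sup>2 *\<^sub>R norm_laplacian W"

text \<open>Matrix powers are iterated \<open>**\<close>: on \<^typ>\<open>real^'n^'n\<close> both \<open>*\<close> and \<open>^\<close> act
  componentwise.\<close>

definition laplacian_kernel :: "nat \<Rightarrow> real \<Rightarrow> real^'n^'n \<Rightarrow> real^'n^'n" where
  "laplacian_kernel d \<sigma> W = (((**) (matrix_inv (shifted_laplacian \<sigma> W))) ^^ d) (mat 1)"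

definition walk_matrix :: "real \<Rightarrow> real^'n^'n \<Rightarrow> real^'n^'n" where
  "walk_matrix \<sigma> W = (\<chi> v w.
     if w \<in> neighbors W v
     then \<sigma>\<^sup>2 / (\<sigma>\<^sup>2 + 1) * (W $ v $ w / sqrt (deg W v * deg W w))
     else 0)"

text \<open>A strategy maps the current vertex, the graph and the history to the law of the next vertex.
  The history is the full list of edges traversed so far in the run, over all its walks; as
  strategies are arbitrary functions of it, this covers every history computed from that list.\<close>

type_synonym 'n strategy = "'n \<Rightarrow> real^'n^'n \<Rightarrow> ('n \<times> 'n) list \<Rightarrow> 'n pmf"

definition sampling_strategy_on :: "real^'n^'n \<Rightarrow> 'n strategy \<Rightarrow> bool" where
  "sampling_strategy_on U sample \<longleftrightarrow>
     (\<forall>v H. neighbors U v \<noteq> {} \<longrightarrow> set_pmf (sample v U H) \<subseteq> neighbors U v)"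

definition nondegenerate_on :: "real^'n^'n \<Rightarrow> 'n strategy \<Rightarrow> bool" where
  "nondegenerate_on U sample \<longleftrightarrow> (\<forall>v H. \<forall>w\<in>neighbors U v. 0 < pmf (sample v U H) w)"

text \<open>The remainder of a single random walk at current vertex \<open>v\<close>. It returns the updated
  unnormalised signature vector and history; nontermination is the missing mass of the
  \<^typ>\<open>'a spmf\<close>, which is \<open>0\<close> by \<open>lossless_walk\<close> below.\<close>

partial_function (spmf) walk ::
  "'n strategy \<Rightarrow> real^'n^'n \<Rightarrow> real \<Rightarrow> 'n \<Rightarrow> real \<Rightarrow> real^'n \<Rightarrow> ('n \<times> 'n) list \<Rightarrow>
     ((real^'n) \<times> ('n \<times> 'n) list) spmf" where
  "walk sample U p_term v load \<phi> H =
     bind_spmf (spmf_of_pmf (bernoulli_pmf p_term)) (\<lambda>stop.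
       if stop \<or> neighbors U v = {} then return_spmf (\<phi>, H)
       else bind_spmf (spmf_of_pmf (sample v U H)) (\<lambda>w.
         let load' = load * (U $ v $ w / (pmf (sample v U H) w * (1 - p_term)))
         in walk sample U p_term w load' (\<phi> + axis w load') (H @ [(v, w)])))"

primrec walks ::
  "'n strategy \<Rightarrow> real^'n^'n \<Rightarrow> real \<Rightarrow> 'n \<Rightarrow> nat \<Rightarrow> ((real^'n) \<times> ('n \<times> 'n) list) spmf" where
  "walks sample U p_term i 0 = return_spmf (0, [])"
| "walks sample U p_term i (Suc t) =
     bind_spmf (walks sample U p_term i t) (\<lambda>(\<phi>, H).
       walk sample U p_term i 1 (\<phi> + axis i 1) H)"

definition signature_vector ::
  "'n strategy \<Rightarrow> real^'n^'n \<Rightarrow> real \<Rightarrow> nat \<Rightarrow> 'n \<Rightarrow> (real^'n) spmf" where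
  "signature_vector sample U p_term m i =
     map_spmf (\<lambda>(\<phi>, H). (1 / real m) *\<^sub>R \<phi>) (walks sample U p_term i m)"

lemma lossless_walk:
  assumes p: "0 < p_term" "p_term < 1"
  shows "lossless_spmf (walk sample U p_term v load \<phi> H)"
proof -
  define f where "f = (\<lambda>(v, l, \<phi>, H). weight_spmf (walk sample U p_term v l \<phi> H))"
  define x where "x = (INF s. f s)"
  have bdd: "bdd_below (range f)"
    by (rule bdd_belowI[of _ 0]) (auto simp: f_def weight_spmf_nonneg)
  have x: "x \<le> weight_spmf (walk sample U p_term v l \<phi> H)" for v l \<phi> H
    unfolding x_def using cINF_lower[OF bdd, of "(v, l, \<phi>, H)"] by (simp add: f_def)
  have x1: "x \<le> 1"
    using x weight_spmf_le_1 by (rule order_trans)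
  have step: "p_term + (1 - p_term) * x \<le> weight_spmf (walk sample U p_term v l \<phi> H)"
    (is "?L \<le> _") for v l \<phi> H
  proof (cases "neighbors U v = {}")
    case True
    have "?L \<le> 1"
      using mult_left_mono[OF x1, of "1 - p_term"] p by (simp add: algebra_simps)
    moreover have "walk sample U p_term v l \<phi> H = return_spmf (\<phi>, H)"
      using True by (simp add: walk.simps[of sample U p_term v l \<phi> H] bind_spmf_const)
    ultimately show ?thesis by simp
  next
    case False
    define g where "g = (\<lambda>w. let load' = l * (U $ v $ w / (pmf (sample v U H) w * (1 - p_term)))
         in walk sample U p_term w load' (\<phi> + axis w load') (H @ [(v, w)]))"
    have "x \<le> measure_pmf.expectation (sample v U H) (\<lambda>w. weight_spmf (g w))"
      by (rule measure_pmf.integral_ge_const)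
        (auto simp: g_def Let_def x weight_spmf_nonneg weight_spmf_le_1
          intro!: measure_pmf.integrable_const_bound[where B=1])
    then have "?L \<le> p_term + (1 - p_term) *
        measure_pmf.expectation (sample v U H) (\<lambda>w. weight_spmf (g w))"
      using p by (simp add: mult_left_mono)
    also have "\<dots> = weight_spmf (walk sample U p_term v l \<phi> H)"
    proof -
      have eq: "walk sample U p_term v l \<phi> H =
          bind_spmf (spmf_of_pmf (bernoulli_pmf p_term))
            (\<lambda>stop. if stop then return_spmf (\<phi>, H) else bind_spmf (spmf_of_pmf (sample v U H)) g)"
        using False unfolding g_def by (subst walk.simps) simp
      show ?thesis
        using p unfolding eq weight_bind_spmf[of "spmf_of_pmf (bernoulli_pmf p_term)"]
        by (simp add: weight_bind_spmf[of "spmf_of_pmf (sample v U H)"] o_def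
              del: bind_spmf_of_pmf)
    qed
    finally show ?thesis .
  qed
  have "p_term + (1 - p_term) * x \<le> x"
    by (subst (2) x_def, rule cINF_greatest) (auto simp: f_def step)
  then have "p_term * 1 \<le> p_term * x"
    by (simp add: algebra_simps)
  then have "1 \<le> x" using p by simp
  then show ?thesis
    using x[of v load \<phi> H] weight_spmf_le_1[of "walk sample U p_term v load \<phi> H"]
    by (simp add: lossless_spmf_def)
qed

lemma lossless_signature_vector:
  assumes "0 < p_term" "p_term < 1"
  shows "lossless_spmf (signature_vector sample U p_term m i)"
proof -
  have "lossless_spmf (walks sample U p_term i t)" for t
    by (induction t) (auto simp: lossless_walk assms)
  then show ?thesis
    by (simp add: signature_vector_def)
qed

end

theory Submission
  imports Defs
begin

text \<open>Dividing the edge weight by the conditional transition probability makes each step of the walk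
  unbiased whatever the history, so a single walk from \<open>i\<close> deposits in expectation the \<open>i\<close>-th row of
  \<open>I + U + U\<^sup>2 + \<dots> = (I - U)\<^sup>-\<^sup>1\<close>. The series converges since \<open>U\<close> contracts the supremum norm
  weighted by \<open>sqrt (deg v)\<close> by the factor \<open>\<sigma>\<^sup>2 / (\<sigma>\<^sup>2 + 1)\<close>. As the shifted Laplacian \<open>S\<close> equals
  \<open>(\<sigma>\<^sup>2 + 1) (I - U)\<close>, this gives \<open>E C = E C' = S\<^sup>-\<^sup>1\<close>, and independence yields
  \<open>E (C (S C')\<^sup>T) = S\<^sup>-\<^sup>1 (S S\<^sup>-\<^sup>1)\<^sup>T = S\<^sup>-\<^sup>1\<close>. The loads are unbounded, because the transition
  probabilities need not be bounded below over all histories; all walk expectations are therefore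
  computed as integrals of nonnegative functions.\<close>

section \<open>Nonnegative integrals over sub-probability mass functions\<close>

lemma nn_integral_bind_spmf:
  "(\<integral>\<^sup>+x. f x \<partial>measure_spmf (bind_spmf p k)) =
     (\<integral>\<^sup>+y. (\<integral>\<^sup>+x. f x \<partial>measure_spmf (k y)) \<partial>measure_spmf p)"
  unfolding measure_spmf_bind o_def
  by (subst nn_integral_bind[where B = "count_space UNIV"])
    (auto simp: space_measure_spmf space_subprob_algebra)

text \<open>Monotone convergence along a chain that need not be a sequence: the support of the limit
  is countable, so the integral is a countable sum of pointwise suprema.\<close>

lemma nn_integral_lub_spmf:
  assumes chain: "Complete_Partial_Order.chain (ord_spmf (=)) Y" and Y: "Y \<noteq> {}"
  shows "(\<integral>\<^sup>+x. f x \<partial>measure_spmf (lub_spmf Y)) = (SUP p\<in>Y. \<integral>\<^sup>+x. f x \<partial>measure_spmf p)"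
proof -
  let ?M = "count_space (set_spmf (lub_spmf Y))"
  have chain': "Complete_Partial_Order.chain (\<le>) ((\<lambda>p x. ennreal (spmf p x) * f x) ` Y)"
    using chain
    by (rule chain_imageI) (auto simp: le_fun_def dest: ord_spmf_eq_leD intro!: mult_right_mono)
  have "(\<integral>\<^sup>+x. f x \<partial>measure_spmf (lub_spmf Y)) = (\<integral>\<^sup>+x. ennreal (spmf (lub_spmf Y) x) * f x \<partial>?M)"
    by (simp add: nn_integral_measure_spmf')
  also have "\<dots> = (\<integral>\<^sup>+x. (SUP p\<in>Y. ennreal (spmf p x) * f x) \<partial>?M)"
    by (simp add: ennreal_spmf_lub_spmf[OF chain Y] SUP_mult_right_ennreal Y)
  also have "\<dots> = (SUP p\<in>Y. \<integral>\<^sup>+x. ennreal (spmf p x) * f x \<partial>?M)"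
    using Y chain' by (rule nn_integral_monotone_convergence_SUP_countable) simp
  \<comment> \<open>The support of each \<open>p\<close> in \<open>Y\<close> lies inside that of the
    limit, so restricting the sum to the latter loses nothing.\<close>
  also have "\<dots> = (SUP p\<in>Y. \<integral>\<^sup>+x. f x \<partial>measure_spmf p)"
    by (auto simp: nn_integral_measure_spmf nn_integral_count_space_indicator
        set_lub_spmf[OF chain] in_set_spmf_iff_spmf
        intro!: arg_cong[of _ _ Sup] image_cong nn_integral_cong split: split_indicator)
  finally show ?thesis .
qed

text \<open>Upper bounds on an integral survive suprema of chains; this is what lets fixed-point
  induction on \<open>walk\<close> prove them.\<close>

lemma admissible_nn_integral_le:
  "spmf.admissible (\<lambda>f. (\<integral>\<^sup>+x. g x \<partial>measure_spmf (f a)) \<le> b)"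
proof (rule ccpo.admissibleI)
  fix A :: "('a \<Rightarrow> 'b spmf) set"
  assume chain: "Complete_Partial_Order.chain spmf.le_fun A" and A: "A \<noteq> {}"
    and le: "\<forall>f\<in>A. (\<integral>\<^sup>+x. g x \<partial>measure_spmf (f a)) \<le> b"
  have "{y. \<exists>f\<in>A. y = f a} \<noteq> {}" using A by auto
  from nn_integral_lub_spmf[OF chain_fun[OF chain, of a] this]
  show "(\<integral>\<^sup>+x. g x \<partial>measure_spmf (spmf.lub_fun A a)) \<le> b"
    using le by (auto simp: fun_lub_def intro!: SUP_least)
qed

section \<open>A single transition of the walk\<close>

text \<open>Abstracts the body of \<open>walk\<close> from its continuation \<open>k\<close>, so
  that the same computation applies both to \<open>walk\<close> itself and to the approximants in
  fixed-point induction.\<close>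

lemma nn_integral_walk_body:
  fixes q :: "'n::finite pmf"
  assumes p: "0 \<le> p" "p \<le> 1"
  shows "(\<integral>\<^sup>+x. f x \<partial>measure_spmf (bind_spmf (spmf_of_pmf (bernoulli_pmf p)) (\<lambda>stop.
           if stop \<or> E then return_spmf y else bind_spmf (spmf_of_pmf q) k))) =
         ennreal p * f y + ennreal (1 - p) *
           (if E then f y else \<Sum>w\<in>UNIV. ennreal (pmf q w) * (\<integral>\<^sup>+x. f x \<partial>measure_spmf (k w)))"
  using p
  by (simp add: nn_integral_bind_spmf nn_integral_measure_pmf nn_integral_count_space_finite
     measure_spmf_return_spmf nn_integral_return UNIV_bool add.commute mult.commute del: bind_spmf_of_pmf)

lemma axis_nonneg: "0 \<le> a \<Longrightarrow> 0 \<le> axis i (a::real) $ j"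
  by (simp add: axis_def)

text \<open>Loads stay nonnegative, so deposits only add to the vector. This makes signature vectors
  nonnegative and starts the induction for the lower bound on expectations.\<close>

lemma walk_increasing:
  assumes "0 \<le> load" "p_term < 1" "\<And>v w. 0 \<le> U $ v $ w"
    and "x \<in> set_spmf (walk sample U p_term v load \<phi> H)"
  shows "\<phi> $ j \<le> fst x $ j"
proof -
  have "\<forall>v load \<phi> H x. 0 \<le> load \<longrightarrow> x \<in> set_spmf (walk sample U p_term v load \<phi> H) \<longrightarrow>
      \<phi> $ j \<le> fst x $ j"
  proof (rule walk.fixp_induct[where P = "\<lambda>f. \<forall>v load \<phi> H x. 0 \<le> load \<longrightarrow>
      x \<in> set_spmf (f sample U p_term v load \<phi> H) \<longrightarrow> \<phi> $ j \<le> fst x $ j"], goal_cases)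
    case 1
    show ?case by (simp add: curry_def)
  next
    case 2
    show ?case by simp
  next
    case (3 f)
    show ?case
    proof (intro allI impI, goal_cases)
      case (1 v load \<phi> H x)
      from 1(2) consider "x = (\<phi>, H)" |
        w where "0 \<le> load * (U $ v $ w / (pmf (sample v U H) w * (1 - p_term)))"
          "x \<in> set_spmf (f sample U p_term w (load * (U $ v $ w / (pmf (sample v U H) w * (1 - p_term))))
            (\<phi> + axis w (load * (U $ v $ w / (pmf (sample v U H) w * (1 - p_term))))) (H @ [(v, w)]))"
        using assms(2,3) 1(1)
        by (auto simp: Let_def set_bind_spmf bind_UNION simp del: bind_spmf_of_pmf split: if_splits)
      then show ?case
      proof cases
        case 1
        then show ?thesis by simp
      next
        case 2
        then have "(\<phi> + axis w (load * (U $ v $ w / (pmf (sample v U H) w * (1 - p_term))))) $ j \<le> fst x $ j"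
          using 3 by blast
        then show ?thesis using 2(1) by (simp add: axis_def split: if_splits)
      qed
    qed
  qed
  then show ?thesis using assms by blast
qed

lemma nonneighbor_weight:
  "0 \<le> U $ v $ w \<Longrightarrow> w \<notin> neighbors U v \<Longrightarrow> U $ v $ w = 0"
  by (simp add: neighbors_def)

text \<open>The unbiasedness of one transition: the denominator in \<open>l w\<close> cancels the
  probability of surviving and moving to \<open>w\<close>, leaving the edge weight. Here
  \<open>T $ w $ j\<close> stands for the later deposit at \<open>j\<close> per unit of load at
  \<open>w\<close>; taking for \<open>T\<close> the full sum or a partial sum of the series serves
  the upper and the lower bound.\<close>

lemma expectation_step:
  fixes U T :: "real^'n^'n" and q :: "'n pmf"
  assumes p: "0 < p" "p < 1" and U: "\<And>w. 0 \<le> U $ v $ w" and T: "\<And>w. 0 \<le> T $ w $ j"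
    and q: "\<And>w. w \<in> neighbors U v \<Longrightarrow> 0 < pmf q w"
    and load: "0 \<le> load" and \<phi>: "0 \<le> \<phi> $ j"
    and l: "\<And>w. l w = load * (U $ v $ w / (pmf q w * (1 - p)))"
  shows "ennreal p * ennreal (\<phi> $ j) + ennreal (1 - p) *
      (if neighbors U v = {} then ennreal (\<phi> $ j)
       else \<Sum>w\<in>UNIV. ennreal (pmf q w) * ennreal ((\<phi> + axis w (l w)) $ j + l w * T $ w $ j)) =
    ennreal (\<phi> $ j + load * (U + U ** T) $ v $ j)"
proof (cases "neighbors U v = {}")
  case True
  then have "U $ v $ w = 0" for w
    using nonneighbor_weight[OF U, of w] by blast
  then have "(U + U ** T) $ v $ j = 0"
    by (simp add: matrix_matrix_mult_def)
  moreover have "ennreal p * ennreal (\<phi> $ j) + ennreal (1 - p) * ennreal (\<phi> $ j) = ennreal (\<phi> $ j)"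
  proof -
    have "ennreal p + ennreal (1 - p) = 1"
      using p by (simp flip: ennreal_plus)
    then show ?thesis by (metis distrib_right mult_1)
  qed
  ultimately show ?thesis
    using True by simp
next
  case False
  have l0: "0 \<le> l w" for w using p load U by (simp add: l)
  \<comment> \<open>At a neighbor the transition probability is positive and cancels; elsewhere the
    edge weight is zero and so is \<open>l w\<close>.\<close>
  have pl: "pmf q w * l w * (1 - p) = load * U $ v $ w" for w
  proof (cases "w \<in> neighbors U v")
    case True
    then show ?thesis using q[of w] p by (simp add: l)
  next
    case False
    then show ?thesis using nonneighbor_weight[OF U, of w] by (simp add: l)
  qed
  have "(1 - p) * (\<Sum>w\<in>UNIV. pmf q w * ((\<phi> + axis w (l w)) $ j + l w * T $ w $ j)) =
      (\<Sum>w\<in>UNIV. (1 - p) * \<phi> $ j * pmf q w + (if w = j then pmf q w * l w * (1 - p) else 0)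
         + (pmf q w * l w * (1 - p)) * T $ w $ j)"
    unfolding sum_distrib_left
    by (rule sum.cong) (auto simp: axis_def algebra_simps)
  also have "\<dots> = (1 - p) * \<phi> $ j + load * U $ v $ j + load * (U ** T) $ v $ j"
    unfolding pl sum.distrib sum_distrib_left[symmetric]
    by (simp add: sum_pmf_eq_1 matrix_matrix_mult_def sum_distrib_left mult.assoc)
  finally have *: "p * \<phi> $ j + (1 - p) * (\<Sum>w\<in>UNIV. pmf q w * ((\<phi> + axis w (l w)) $ j + l w * T $ w $ j)) =
     \<phi> $ j + load * (U + U ** T) $ v $ j"
    by (simp add: algebra_simps)
  have nn: "0 \<le> (\<phi> + axis w (l w)) $ j + l w * T $ w $ j" for w
    using l0[of w] T \<phi> by (simp add: axis_def)
  let ?S = "\<Sum>w\<in>UNIV. pmf q w * ((\<phi> + axis w (l w)) $ j + l w * T $ w $ j)"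
  have S: "0 \<le> ?S"
    by (intro sum_nonneg mult_nonneg_nonneg pmf_nonneg nn)
  have "(\<Sum>w\<in>UNIV. ennreal (pmf q w) * ennreal ((\<phi> + axis w (l w)) $ j + l w * T $ w $ j)) = ennreal ?S"
    by (subst sum_ennreal[symmetric]) (simp_all only: ennreal_mult nn pmf_nonneg mult_nonneg_nonneg)
  moreover have "ennreal p * ennreal (\<phi> $ j) + ennreal (1 - p) * ennreal ?S = ennreal (p * \<phi> $ j + (1 - p) * ?S)"
    using p \<phi> S
    by (simp only: ennreal_mult ennreal_plus mult_nonneg_nonneg less_imp_le diff_ge_0_iff_ge)
  ultimately show ?thesis
    unfolding if_not_P[OF False] * by simp
qed

section \<open>Expected deposits of one walk\<close>

text \<open>The partial sum of the powers of \<open>U\<close> with exponents 1 to \<open>k\<close>.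
  The identity term is absent because the deposit at the starting vertex is made in
  \<open>walks\<close>, not in \<open>walk\<close>.\<close>

primrec walk_series :: "real^'n^'n \<Rightarrow> nat \<Rightarrow> real^'n^'n" where
  "walk_series U 0 = 0"
| "walk_series U (Suc k) = U + U ** walk_series U k"

lemma walk_series_nonneg:
  assumes "\<And>v w. 0 \<le> U $ v $ w"
  shows "0 \<le> walk_series U k $ v $ w"
  by (induction k arbitrary: v w) (auto simp: matrix_matrix_mult_def assms intro!: add_nonneg_nonneg sum_nonneg)

text \<open>The two bounds come from different principles: the upper one from \<open>walk\<close> being a least fixed
  point, the lower one from unfolding \<open>k\<close> steps and from almost sure termination.\<close>

lemma nn_integral_walk_le:
  fixes U G :: "real^'n^'n"
  assumes p: "0 < p_term" "p_term < 1" and U: "\<And>v w. 0 \<le> U $ v $ w"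
    and sample: "nondegenerate_on U sample"
    and G: "U + U ** G = G" "\<And>v w. 0 \<le> G $ v $ w"
    and "0 \<le> load" "0 \<le> \<phi> $ j"
  shows "(\<integral>\<^sup>+x. ennreal (fst x $ j) \<partial>measure_spmf (walk sample U p_term v load \<phi> H))
    \<le> ennreal (\<phi> $ j + load * G $ v $ j)"
proof -
  \<comment> \<open>Vertex, load, vector and history all change along the walk, so the induction
    must quantify over them.\<close>
  define P where "P = (\<lambda>f. \<forall>v load (\<phi>::real^'n) (H::('n \<times> 'n) list). 0 \<le> load \<longrightarrow> 0 \<le> \<phi> $ j \<longrightarrow>
      (\<integral>\<^sup>+x. ennreal (fst (x::(real^'n) \<times> ('n \<times> 'n) list) $ j) \<partial>measure_spmf (f sample U p_term v load \<phi> H))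
      \<le> ennreal (\<phi> $ j + load * G $ v $ j))"
  have "P walk"
  proof (rule walk.fixp_induct[where P = P], goal_cases)
    case 1
    show ?case
      unfolding P_def curry_def
      by (intro admissible_all admissible_imp admissible_nn_integral_le)
  next
    case 2
    show ?case by (simp add: P_def)
  next
    case (3 f)
    show ?case
      unfolding P_def
    proof (intro allI impI, goal_cases)
      case (1 v load \<phi> H)
      let ?q = "sample v U H"
      define l where "l w = load * (U $ v $ w / (pmf ?q w * (1 - p_term)))" for w
      have q: "0 < pmf ?q w" if "w \<in> neighbors U v" for w
        using sample that by (simp add: nondegenerate_on_def)
      have l0: "0 \<le> l w" for w using p U 1 by (simp add: l_def)
      have IH: "(\<integral>\<^sup>+x. ennreal (fst x $ j) \<partial>measure_spmf (f sample U p_term w (l w) (\<phi> + axis w (l w)) (H @ [(v, w)])))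
         \<le> ennreal ((\<phi> + axis w (l w)) $ j + l w * G $ w $ j)" for w
      proof -
        have "0 \<le> (\<phi> + axis w (l w)) $ j" using 1 axis_nonneg[OF l0, of w w j] by simp
        then show ?thesis using 3 l0[of w] unfolding P_def by blast
      qed
      have "ennreal p_term * ennreal (\<phi> $ j) + ennreal (1 - p_term) *
          (if neighbors U v = {} then ennreal (\<phi> $ j)
           else \<Sum>w\<in>UNIV. ennreal (pmf ?q w) * (\<integral>\<^sup>+x. ennreal (fst x $ j)
             \<partial>measure_spmf (f sample U p_term w (l w) (\<phi> + axis w (l w)) (H @ [(v, w)]))))
        \<le> ennreal p_term * ennreal (\<phi> $ j) + ennreal (1 - p_term) *
          (if neighbors U v = {} then ennreal (\<phi> $ j)
           else \<Sum>w\<in>UNIV. ennreal (pmf ?q w) * ennreal ((\<phi> + axis w (l w)) $ j + l w * G $ w $ j))"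
      proof (cases "neighbors U v = {}")
        case False
        then show ?thesis
          unfolding if_not_P[OF False]
          by (intro add_left_mono mult_left_mono sum_mono IH zero_le)
      qed simp
      also have "\<dots> = ennreal (\<phi> $ j + load * (U + U ** G) $ v $ j)"
        by (rule expectation_step[OF p U G(2) q 1 l_def])
      finally show ?case
        unfolding Let_def l_def[symmetric] G(1)
        by (simp only: nn_integral_walk_body[OF p[THEN less_imp_le]] fst_conv)
    qed
  qed
  then show ?thesis using assms(7,8) unfolding P_def by blast
qed

lemma nn_integral_walk_ge:
  fixes U :: "real^'n^'n"
  assumes p: "0 < p_term" "p_term < 1" and U: "\<And>v w. 0 \<le> U $ v $ w"
    and sample: "nondegenerate_on U sample"
    and "0 \<le> load" "0 \<le> \<phi> $ j"
  shows "ennreal (\<phi> $ j + load * walk_series U k $ v $ j)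
    \<le> (\<integral>\<^sup>+x. ennreal (fst x $ j) \<partial>measure_spmf (walk sample U p_term v load \<phi> H))"
  using assms(5,6)
proof (induction k arbitrary: v load \<phi> H)
  case 0
  \<comment> \<open>A constant integrates to itself only because the walk terminates almost surely,
    so that no mass is missing.\<close>
  have "ennreal (\<phi> $ j) = (\<integral>\<^sup>+x. ennreal (\<phi> $ j) \<partial>measure_spmf (walk sample U p_term v load \<phi> H))"
    using lossless_walk[OF p, of sample U v load \<phi> H]
    by (simp add: measure_spmf.emeasure_eq_measure lossless_spmf_def weight_spmf_def space_measure_spmf)
  also have "\<dots> \<le> (\<integral>\<^sup>+x. ennreal (fst x $ j) \<partial>measure_spmf (walk sample U p_term v load \<phi> H))"
    using walk_increasing[OF 0(1) p(2) U] by (intro nn_integral_mono_AE) (auto intro!: ennreal_leI)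
  finally show ?case by simp
next
  case (Suc k)
  let ?q = "sample v U H"
  define l where "l w = load * (U $ v $ w / (pmf ?q w * (1 - p_term)))" for w
  have q: "0 < pmf ?q w" if "w \<in> neighbors U v" for w
    using sample that by (simp add: nondegenerate_on_def)
  have l0: "0 \<le> l w" for w using p U Suc.prems by (simp add: l_def)
  have IH: "ennreal ((\<phi> + axis w (l w)) $ j + l w * walk_series U k $ w $ j) \<le>
      (\<integral>\<^sup>+x. ennreal (fst x $ j)
        \<partial>measure_spmf (walk sample U p_term w (l w) (\<phi> + axis w (l w)) (H @ [(v, w)])))" for w
    using l0[of w] Suc.prems axis_nonneg[of "l w" w j] by (intro Suc.IH) simp_all
  have "ennreal (\<phi> $ j + load * walk_series U (Suc k) $ v $ j) =
      ennreal p_term * ennreal (\<phi> $ j) + ennreal (1 - p_term) *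
      (if neighbors U v = {} then ennreal (\<phi> $ j)
       else \<Sum>w\<in>UNIV. ennreal (pmf ?q w) *
         ennreal ((\<phi> + axis w (l w)) $ j + l w * walk_series U k $ w $ j))"
    unfolding walk_series.simps
    by (rule expectation_step[OF p U walk_series_nonneg[OF U] q Suc.prems l_def, symmetric])
  also have "\<dots> \<le> ennreal p_term * ennreal (\<phi> $ j) + ennreal (1 - p_term) *
          (if neighbors U v = {} then ennreal (\<phi> $ j)
           else \<Sum>w\<in>UNIV. ennreal (pmf ?q w) * (\<integral>\<^sup>+x. ennreal (fst x $ j)
             \<partial>measure_spmf (walk sample U p_term w (l w) (\<phi> + axis w (l w)) (H @ [(v, w)]))))"
  proof (cases "neighbors U v = {}")
    case False
    then show ?thesis
      unfolding if_not_P[OF False]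
      by (intro add_left_mono mult_left_mono sum_mono IH zero_le)
  qed simp
  also have "\<dots> = (\<integral>\<^sup>+x. ennreal (fst x $ j) \<partial>measure_spmf (walk sample U p_term v load \<phi> H))"
    \<comment> \<open>Only the right-hand occurrence is unfolded; the first one is the continuation
      under the sum.\<close>
    by (subst (2) walk.simps, unfold Let_def l_def[symmetric])
      (simp only: nn_integral_walk_body[OF p[THEN less_imp_le]] fst_conv)
  finally show ?case .
qed

text \<open>The fixed-point equation for \<open>G\<close> gives the upper bound, and convergence of
  the partial sums to \<open>G\<close> gives both its nonnegativity and the matching lower
  bound.\<close>

lemma nn_integral_walk:
  fixes U G :: "real^'n^'n"
  assumes p: "0 < p_term" "p_term < 1" and U: "\<And>v w. 0 \<le> U $ v $ w"
    and sample: "nondegenerate_on U sample"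
    and G: "U + U ** G = G" "\<And>v w. (\<lambda>k. walk_series U k $ v $ w) \<longlonglongrightarrow> G $ v $ w"
    and l\<phi>: "0 \<le> load" "0 \<le> \<phi> $ j"
  shows "(\<integral>\<^sup>+x. ennreal (fst x $ j) \<partial>measure_spmf (walk sample U p_term v load \<phi> H))
    = ennreal (\<phi> $ j + load * G $ v $ j)"
proof (rule antisym)
  have "0 \<le> G $ v $ w" for v w
    by (rule LIMSEQ_le_const[OF G(2)]) (auto simp: walk_series_nonneg U)
  then show "(\<integral>\<^sup>+x. ennreal (fst x $ j) \<partial>measure_spmf (walk sample U p_term v load \<phi> H))
    \<le> ennreal (\<phi> $ j + load * G $ v $ j)"
    using assms by (intro nn_integral_walk_le)
  have "(\<lambda>k. ennreal (\<phi> $ j + load * walk_series U k $ v $ j)) \<longlonglongrightarrow> ennreal (\<phi> $ j + load * G $ v $ j)"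
    by (intro tendsto_intros G)
  then show "ennreal (\<phi> $ j + load * G $ v $ j)
    \<le> (\<integral>\<^sup>+x. ennreal (fst x $ j) \<partial>measure_spmf (walk sample U p_term v load \<phi> H))"
    using nn_integral_walk_ge[OF p U sample l\<phi>] by (intro LIMSEQ_le_const2) auto
qed

section \<open>Several walks and the signature vector\<close>

lemma walks_nonneg:
  assumes "p_term < 1" "\<And>v w. 0 \<le> U $ v $ w" "x \<in> set_spmf (walks sample U p_term i t)"
  shows "0 \<le> fst x $ j"
  using assms(3)
proof (induction t arbitrary: x)
  case (Suc t)
  then obtain y where y: "y \<in> set_spmf (walks sample U p_term i t)"
    "x \<in> set_spmf (walk sample U p_term i 1 (fst y + axis i 1) (snd y))"
    by (auto simp: set_bind_spmf bind_UNION)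
  show ?case
    using Suc.IH[OF y(1)] walk_increasing[OF _ assms(1,2) y(2), of j]
    by (auto simp: axis_def split: if_splits)
qed simp

text \<open>The expected deposit of one walk is the same from every history, so the walks contribute
  equally although later ones may depend on earlier ones. The term \<open>mat 1\<close> is the
  initial deposit.\<close>

lemma nn_integral_walks:
  fixes U G :: "real^'n^'n"
  assumes p: "0 < p_term" "p_term < 1" and U: "\<And>v w. 0 \<le> U $ v $ w"
    and sample: "nondegenerate_on U sample"
    and G: "U + U ** G = G" "\<And>v w. (\<lambda>k. walk_series U k $ v $ w) \<longlonglongrightarrow> G $ v $ w"
  shows "(\<integral>\<^sup>+x. ennreal (fst x $ j) \<partial>measure_spmf (walks sample U p_term i t))
    = ennreal (real t * (mat 1 + G) $ i $ j)"
proof (induction t)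
  case 0
  then show ?case by (simp add: measure_spmf_return_spmf nn_integral_return)
next
  case (Suc t)
  have G0: "0 \<le> (mat 1 + G) $ i $ j"
    using LIMSEQ_le_const[OF G(2), of 0 i j] by (auto simp: walk_series_nonneg U mat_def)
  have lossless: "lossless_spmf (walks sample U p_term i t)"
    by (induction t) (auto simp: lossless_walk p)
  have "(\<integral>\<^sup>+x. ennreal (fst x $ j) \<partial>measure_spmf (walks sample U p_term i (Suc t))) =
     (\<integral>\<^sup>+y. (\<integral>\<^sup>+x. ennreal (fst x $ j) \<partial>measure_spmf (walk sample U p_term i 1 (fst y + axis i 1) (snd y)))
        \<partial>measure_spmf (walks sample U p_term i t))"
    by (simp add: nn_integral_bind_spmf case_prod_beta)
  also have "\<dots> = (\<integral>\<^sup>+y. ennreal (fst y $ j) + ennreal ((mat 1 + G) $ i $ j) \<partial>measure_spmf (walks sample U p_term i t))"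
  proof (intro nn_integral_cong_AE, simp, intro ballI)
    fix y assume "y \<in> set_spmf (walks sample U p_term i t)"
    then have y: "0 \<le> fst y $ j" by (rule walks_nonneg[OF p(2) U])
    then show "(\<integral>\<^sup>+x. ennreal (fst x $ j) \<partial>measure_spmf (walk sample U p_term i 1 (fst y + axis i 1) (snd y)))
      = ennreal (fst y $ j) + ennreal (mat 1 $ i $ j + G $ i $ j)"
      using G0 by (subst nn_integral_walk[OF p U sample G])
        (auto simp: axis_def mat_def ac_simps simp flip: ennreal_plus)
  qed
  also have "\<dots> = ennreal (real t * (mat 1 + G) $ i $ j) + ennreal ((mat 1 + G) $ i $ j)"
    using lossless by (simp add: nn_integral_add Suc measure_spmf.emeasure_eq_measure
      lossless_spmf_def weight_spmf_def space_measure_spmf)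
  also have "\<dots> = ennreal (real (Suc t) * (mat 1 + G) $ i $ j)"
    using G0 by (subst ennreal_plus[symmetric]) (auto simp: algebra_simps simp del: vector_add_component)
  finally show ?case .
qed


text \<open>Entries are nonnegative, so finiteness of the nonnegative integral already yields
  integrability; averaging cancels the factor \<open>m\<close>.\<close>

lemma has_bochner_integral_signature_vector:
  fixes U G :: "real^'n^'n"
  assumes p: "0 < p_term" "p_term < 1" and U: "\<And>v w. 0 \<le> U $ v $ w"
    and sample: "nondegenerate_on U sample" and m: "m \<ge> 1"
    and G: "U + U ** G = G" "\<And>v w. (\<lambda>k. walk_series U k $ v $ w) \<longlonglongrightarrow> G $ v $ w"
  shows "has_bochner_integral (measure_spmf (signature_vector sample U p_term m i)) (\<lambda>x. x $ j)
    ((mat 1 + G) $ i $ j)"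
proof -
  let ?ws = "walks sample U p_term i m"
  have R0: "0 \<le> (mat 1 + G) $ i $ j"
    using LIMSEQ_le_const[OF G(2), of 0 i j] by (auto simp: walk_series_nonneg U mat_def)
  have "has_bochner_integral (measure_spmf ?ws) (\<lambda>x. fst x $ j) (real m * (mat 1 + G) $ i $ j)"
  proof (rule has_bochner_integral_nn_integral)
    show "AE x in measure_spmf ?ws. 0 \<le> fst x $ j"
      using walks_nonneg[OF p(2) U] by simp
    show "(\<integral>\<^sup>+x. ennreal (fst x $ j) \<partial>measure_spmf ?ws) = ennreal (real m * (mat 1 + G) $ i $ j)"
      by (rule nn_integral_walks[OF p U sample G])
  qed (use R0 in simp_all)
  then have "has_bochner_integral (measure_spmf ?ws) (\<lambda>x. 1 / real m * fst x $ j)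
      (1 / real m * (real m * (mat 1 + G) $ i $ j))"
    by (rule has_bochner_integral_mult_right)
  then show ?thesis
    using m
    by (simp add: signature_vector_def measure_map_spmf_conv_distr has_bochner_integral_distr case_prod_beta)
qed

section \<open>Contraction in a weighted supremum norm and the Neumann series\<close>

lemma matrix_diff_ldistrib:
  fixes A :: "'a::ring_1^'n^'m" and B C :: "'a^'p^'n"
  shows "A ** (B - C) = A ** B - A ** C"
  by (simp add: matrix_matrix_mult_def vec_eq_iff algebra_simps sum_subtractf)

lemma matrix_diff_rdistrib:
  fixes A B :: "'a::ring_1^'n^'m" and C :: "'a^'p^'n"
  shows "(A - B) ** C = A ** C - B ** C"
  by (simp add: matrix_matrix_mult_def vec_eq_iff algebra_simps sum_subtractf)

text \<open>In the norm given by the maximum of \<open>\<bar>x $ v\<bar> / s v\<close>, the matrix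
  \<open>U\<close> has operator norm at most \<open>c\<close>.\<close>

lemma subinvariant_contraction:
  fixes U :: "real^'n^'n" and s :: "'n \<Rightarrow> real"
  assumes U: "\<And>v w. 0 \<le> U $ v $ w" and s: "\<And>v. (\<Sum>w\<in>UNIV. U $ v $ w * s w) \<le> c * s v"
    and K: "0 \<le> K" and x: "\<And>v. \<bar>x $ v\<bar> \<le> K * s v"
  shows "\<bar>(U *v x) $ v\<bar> \<le> c * K * s v"
proof -
  have "\<bar>(U *v x) $ v\<bar> \<le> (\<Sum>w\<in>UNIV. \<bar>U $ v $ w * x $ w\<bar>)"
    unfolding matrix_vector_mult_def by simp
  also have "\<dots> \<le> (\<Sum>w\<in>UNIV. U $ v $ w * (K * s w))"
    using U x by (intro sum_mono) (auto simp: abs_mult intro!: mult_left_mono)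
  also have "\<dots> = K * (\<Sum>w\<in>UNIV. U $ v $ w * s w)"
    by (simp add: sum_distrib_left mult_ac)
  also have "\<dots> \<le> K * (c * s v)"
    by (intro mult_left_mono s K)
  finally show ?thesis by (simp add: mult_ac)
qed

lemma subinvariant_iterates_tendsto_0:
  fixes U :: "real^'n^'n" and s :: "'n \<Rightarrow> real" and x :: "nat \<Rightarrow> real^'n"
  assumes U: "\<And>v w. 0 \<le> U $ v $ w" and s: "\<And>v. 0 < s v"
    "\<And>v. (\<Sum>w\<in>UNIV. U $ v $ w * s w) \<le> c * s v"
    and c: "0 \<le> c" "c < 1" and x: "\<And>k. x (Suc k) = U *v x k"
  shows "(\<lambda>k. x k $ v) \<longlonglongrightarrow> 0"
proof -
  \<comment> \<open>A sum in place of the maximum: any upper bound for the weighted norm of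
    \<open>x 0\<close> suffices.\<close>
  define K where "K = (\<Sum>v\<in>UNIV. \<bar>x 0 $ v\<bar> / s v)"
  have K: "0 \<le> K" unfolding K_def using s(1) by (intro sum_nonneg) (simp add: less_imp_le)
  have bound: "\<bar>x k $ v\<bar> \<le> c ^ k * K * s v" for k v
  proof (induction k arbitrary: v)
    case 0
    have "\<bar>x 0 $ v\<bar> / s v \<le> K"
      unfolding K_def using s(1) by (intro member_le_sum) (auto simp: less_imp_le)
    then show ?case using s(1)[of v] by (simp add: field_simps)
  next
    case (Suc k)
    have "\<bar>(U *v x k) $ v\<bar> \<le> c * (c ^ k * K) * s v"
      using c K by (intro subinvariant_contraction U s(2) Suc) simp
    then show ?case by (simp add: x mult_ac)
  qed
  have "(\<lambda>k. c ^ k * K * s v) \<longlonglongrightarrow> 0"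
    using c by (intro tendsto_mult_left_zero LIMSEQ_realpow_zero)
  then show ?thesis
    by (rule Lim_null_comparison[rotated]) (auto intro!: always_eventually bound)
qed

text \<open>A vector in the kernel is fixed by \<open>U\<close>, so as a constant sequence of
  iterates it must tend to zero.\<close>

lemma subinvariant_invertible:
  fixes U :: "real^'n^'n" and s :: "'n \<Rightarrow> real"
  assumes U: "\<And>v w. 0 \<le> U $ v $ w" and s: "\<And>v. 0 < s v"
    "\<And>v. (\<Sum>w\<in>UNIV. U $ v $ w * s w) \<le> c * s v" and c: "0 \<le> c" "c < 1"
  shows "invertible (mat 1 - U)"
  unfolding invertible_left_inverse matrix_left_invertible_ker
proof (intro allI impI)
  fix x assume "(mat 1 - U) *v x = 0"
  then have "x = U *v x" by (simp add: matrix_vector_mult_diff_rdistrib)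
  then have "(\<lambda>k::nat. x $ v) \<longlonglongrightarrow> 0" for v
    by (intro subinvariant_iterates_tendsto_0[OF U s c])
  then show "x = 0" by (simp add: vec_eq_iff LIMSEQ_const_iff)
qed

text \<open>The error \<open>G - walk_series U k\<close> is multiplied by \<open>U\<close> at each
  step, so each of its columns is a sequence of iterates tending to zero.\<close>

lemma subinvariant_walk_series_tendsto:
  fixes U G :: "real^'n^'n" and s :: "'n \<Rightarrow> real"
  assumes U: "\<And>v w. 0 \<le> U $ v $ w" and s: "\<And>v. 0 < s v"
    "\<And>v. (\<Sum>w\<in>UNIV. U $ v $ w * s w) \<le> c * s v" and c: "0 \<le> c" "c < 1"
    and G: "U + U ** G = G"
  shows "(\<lambda>k. walk_series U k $ v $ w) \<longlonglongrightarrow> G $ v $ w"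
proof -
  have "G - walk_series U (Suc k) = U ** (G - walk_series U k)" for k
    by (subst G[symmetric]) (simp add: matrix_diff_ldistrib)
  then have "(\<lambda>k. column w (G - walk_series U k) $ v) \<longlonglongrightarrow> 0"
    by (intro subinvariant_iterates_tendsto_0[OF U s c])
      (simp only: column_def vec_eq_iff matrix_matrix_mult_def matrix_vector_mult_def vec_lambda_beta; simp)
  then have "(\<lambda>k. G $ v $ w - (G - walk_series U k) $ v $ w) \<longlonglongrightarrow> G $ v $ w - 0"
    by (intro tendsto_diff tendsto_const) (simp add: column_def)
  then show ?thesis by simp
qed

section \<open>The walk matrix and the normalized Laplacian\<close>

lemma deg_pos:
  assumes "weighted_graph W" "w \<in> neighbors W v"
  shows "0 < deg W v" "0 < deg W w"
proof -
  have "0 < deg W v" if "w \<in> neighbors W v" for v w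
    unfolding deg_def using that by (intro sum_pos2[of _ w]) (auto simp: neighbors_def)
  moreover have "v \<in> neighbors W w"
    using assms by (auto simp: weighted_graph_def neighbors_def)
  ultimately show "0 < deg W v" "0 < deg W w" using assms(2) by blast+
qed

lemma walk_matrix_nonneg:
  assumes "weighted_graph W"
  shows "0 \<le> walk_matrix \<sigma> W $ v $ w"
  using deg_pos[OF assms, of w v] assms
  by (auto simp: walk_matrix_def weighted_graph_def intro!: mult_nonneg_nonneg divide_nonneg_nonneg)

text \<open>The weight of the supremum norm. The value 1 at isolated vertices only keeps it
  positive, since the walk matrix has a zero row there.\<close>

definition deg_weight :: "real^'n^'n \<Rightarrow> 'n \<Rightarrow> real" where
  "deg_weight W v = (if deg W v > 0 then sqrt (deg W v) else 1)"

lemma deg_weight_pos: "0 < deg_weight W v"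
  by (simp add: deg_weight_def)

text \<open>The square roots of the degrees form an eigenvector, with eigenvalue 1, of the
  normalized adjacency matrix: \<open>sqrt (deg W w)\<close> cancels in each term and the remaining
  weights sum to \<open>deg W v\<close>.\<close>

lemma walk_matrix_subinvariant:
  assumes W: "weighted_graph W"
  shows "(\<Sum>w\<in>UNIV. walk_matrix \<sigma> W $ v $ w * deg_weight W w) \<le> \<sigma>\<^sup>2 / (\<sigma>\<^sup>2 + 1) * deg_weight W v"
proof -
  let ?c = "\<sigma>\<^sup>2 / (\<sigma>\<^sup>2 + 1)"
  have "(\<Sum>w\<in>UNIV. walk_matrix \<sigma> W $ v $ w * deg_weight W w) =
      (\<Sum>w\<in>neighbors W v. walk_matrix \<sigma> W $ v $ w * deg_weight W w)"
    by (rule sum.mono_neutral_right) (auto simp: walk_matrix_def)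
  also have "\<dots> = (\<Sum>w\<in>neighbors W v. ?c / sqrt (deg W v) * W $ v $ w)"
  proof (rule sum.cong)
    fix w assume w: "w \<in> neighbors W v"
    then show "walk_matrix \<sigma> W $ v $ w * deg_weight W w = ?c / sqrt (deg W v) * W $ v $ w"
      using deg_pos[OF W w] by (simp add: walk_matrix_def deg_weight_def real_sqrt_mult)
  qed simp
  also have "\<dots> = ?c * (deg W v / sqrt (deg W v))"
    by (subst sum_distrib_left[symmetric]) (simp add: deg_def)
  also have "\<dots> \<le> ?c * deg_weight W v"
  proof (rule mult_left_mono)
    have "0 \<le> deg W v" unfolding deg_def by (rule sum_nonneg) (simp add: neighbors_def)
    \<comment> \<open>At an isolated vertex the quotient is \<open>0 / 0 = 0\<close>; otherwise
      equality holds.\<close>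
    then show "deg W v / sqrt (deg W v) \<le> deg_weight W v"
      by (cases "deg W v = 0") (simp_all add: deg_weight_def real_div_sqrt)
  qed simp
  finally show ?thesis .
qed

text \<open>The diagonal of the left side is \<open>\<sigma>\<^sup>2 + 1\<close> and the graph has
  no loops; off the diagonal this factor cancels the denominator in
  \<open>walk_matrix\<close>.\<close>

lemma shifted_laplacian_eq:
  assumes "weighted_graph W"
  shows "shifted_laplacian \<sigma> W = (\<sigma>\<^sup>2 + 1) *\<^sub>R (mat 1 - walk_matrix \<sigma> W)"
proof -
  have "\<sigma>\<^sup>2 + 1 \<noteq> 0" by (metis add_nonneg_eq_0_iff zero_le_power2 zero_le_one zero_neq_one)
  then show ?thesis
    using assms
    by (auto simp: vec_eq_iff shifted_laplacian_def norm_laplacian_def walk_matrix_def mat_def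
        neighbors_def weighted_graph_def)
qed

section \<open>Entrywise integration and the kernel identity\<close>

lemma has_bochner_integral_vec:
  fixes f :: "'a \<Rightarrow> 'b::euclidean_space^'n"
  assumes "\<And>i. has_bochner_integral M (\<lambda>x. f x $ i) (y $ i)"
  shows "has_bochner_integral M f y"
proof -
  have expand: "z = (\<Sum>i\<in>UNIV. axis i (z $ i))" for z :: "'b^'n"
    by (simp add: vec_eq_iff axis_def)
  have "bounded_linear (axis i :: 'b \<Rightarrow> 'b^'n)" for i
    unfolding linear_conv_bounded_linear[symmetric]
    by (rule linearI) (auto simp: vec_eq_iff axis_def)
  then have "has_bochner_integral M (\<lambda>x. \<Sum>i\<in>UNIV. axis i (f x $ i)) (\<Sum>i\<in>UNIV. axis i (y $ i))"
    using assms by (intro has_bochner_integral_sum has_bochner_integral_bounded_linear[of "axis _"])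
  then show ?thesis
    by (simp only: expand[symmetric])
qed

text \<open>\<open>matrix_inv\<close> is a choice; the given inverse shows that the choice satisfies
  its specification, and uniqueness of inverses identifies it.\<close>

lemma matrix_inv_eqI:
  fixes A B :: "real^'n^'n"
  assumes "A ** B = mat 1" "B ** A = mat 1"
  shows "matrix_inv A = B"
proof -
  have "A ** matrix_inv A = mat 1"
    unfolding matrix_inv_def by (rule someI2[of _ B]) (use assms in auto)
  then show ?thesis
    by (metis assms(2) matrix_mul_assoc matrix_mul_lid matrix_mul_rid)
qed

theorem corollary3p4:
  fixes W U :: "real^'n^'n" and \<sigma> p_term :: real and m :: nat
    and sample :: "'n strategy"
    and M :: "'a measure"
    and \<phi> :: "'n \<Rightarrow> 'a \<Rightarrow> real^'n"
    and C C' D :: "'a \<Rightarrow> real^'n^'n"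
  assumes graph: "weighted_graph W"
    and U: "U = walk_matrix \<sigma> W"
    and m: "m \<ge> 1"
    and p_term: "0 < p_term" "p_term < 1"
    and sample: "sampling_strategy_on U sample" "nondegenerate_on U sample"
    and M: "prob_space M"
    and signatures_indep: "prob_space.indep_vars M (\<lambda>_. borel) \<phi> UNIV"
    and signatures_law: "\<And>i. distr M borel (\<phi> i) =
          distr (measure_spmf (signature_vector sample U p_term m i)) borel (\<lambda>x. x)"
    and C: "\<And>\<omega>. C \<omega> = (\<chi> i. (1 / (\<sigma>\<^sup>2 + 1)) *\<^sub>R \<phi> i \<omega>)"
    and C'_indep: "prob_space.indep_var M borel C borel C'"
    and C'_law: "distr M borel C' = distr M borel C"
    and D: "\<And>\<omega>. D \<omega> = shifted_laplacian \<sigma> W ** C' \<omega>"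
  shows "invertible (shifted_laplacian \<sigma> W) \<and>
         laplacian_kernel 1 \<sigma> W = matrix_inv (shifted_laplacian \<sigma> W) \<and>
         integrable M (\<lambda>\<omega>. C \<omega> ** transpose (D \<omega>)) \<and>
         matrix_inv (shifted_laplacian \<sigma> W) =
           prob_space.expectation M (\<lambda>\<omega>. C \<omega> ** transpose (D \<omega>))"
proof -
  interpret prob_space M by (rule M)
  define S where "S = shifted_laplacian \<sigma> W"
  define c where "c = \<sigma>\<^sup>2 / (\<sigma>\<^sup>2 + 1)"
  define a where "a = \<sigma>\<^sup>2 + 1"
  have a: "0 < a" unfolding a_def by (simp add: add_nonneg_pos)
  have c: "0 \<le> c" "c < 1" unfolding c_def using a by (auto simp: a_def)
  have U0: "0 \<le> U $ v $ w" for v w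
    unfolding U by (rule walk_matrix_nonneg[OF graph])
  note sub = U0 deg_weight_pos walk_matrix_subinvariant[OF graph, of \<sigma>, folded U c_def] c
  obtain R where inv: "(mat 1 - U) ** R = mat 1" "R ** (mat 1 - U) = mat 1"
    using subinvariant_invertible[OF sub] unfolding invertible_def by blast
  \<comment> \<open>With \<open>R\<close> the inverse of \<open>mat 1 - U\<close>, the sum of the
    series without its identity term is \<open>R - mat 1\<close>.\<close>
  have G: "U + U ** (R - mat 1) = R - mat 1"
    using inv(1) by (simp add: matrix_diff_rdistrib matrix_diff_ldistrib algebra_simps)
  note series = subinvariant_walk_series_tendsto[OF sub G]
  define P where "P = (1 / a) *\<^sub>R R"
  have S: "S = a *\<^sub>R (mat 1 - U)"
    unfolding S_def a_def U by (rule shifted_laplacian_eq[OF graph])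
  have SP: "S ** P = mat 1" "P ** S = mat 1"
    unfolding S P_def matrix_scalar_ac scalar_matrix_assoc[symmetric] using a inv by simp_all
  then have invertible: "invertible S" unfolding invertible_def by blast
  have P: "matrix_inv S = P"
    by (rule matrix_inv_eqI[OF SP])

  have \<phi>[measurable]: "\<phi> i \<in> borel_measurable M" for i
    using signatures_indep unfolding indep_vars_def by auto
  have \<phi>_int: "integrable M (\<lambda>\<omega>. \<phi> i \<omega> $ k)" "expectation (\<lambda>\<omega>. \<phi> i \<omega> $ k) = R $ i $ k" for i k
  proof -
    let ?N = "measure_spmf (signature_vector sample U p_term m i)"
    have *: "has_bochner_integral ?N (\<lambda>x. x $ k) (R $ i $ k)"
      using has_bochner_integral_signature_vector[OF p_term U0 sample(2) m G series, of i k] by simp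
    \<comment> \<open>\<open>signatures_law\<close> compares laws on the Borel sets, whereas
      \<open>?N\<close> carries the discrete sigma-algebra; integrals therefore pass through image
      measures on both sides.\<close>
    have "integrable (distr ?N borel (\<lambda>x. x)) (\<lambda>x. x $ k)"
      using * by (subst integrable_distr_eq) (auto simp: has_bochner_integral_iff)
    then show "integrable M (\<lambda>\<omega>. \<phi> i \<omega> $ k)"
      unfolding signatures_law[symmetric] by (subst (asm) integrable_distr_eq) auto
    have "expectation (\<lambda>\<omega>. \<phi> i \<omega> $ k) = integral\<^sup>L (distr M borel (\<phi> i)) (\<lambda>x. x $ k)"
      by (subst integral_distr) auto
    also have "\<dots> = R $ i $ k"
      unfolding signatures_law using * by (subst integral_distr) (auto simp: has_bochner_integral_iff)
    finally show "expectation (\<lambda>\<omega>. \<phi> i \<omega> $ k) = R $ i $ k" .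
  qed
  have [measurable]: "C \<in> borel_measurable M" "C' \<in> borel_measurable M"
    using C'_indep by (auto dest: indep_var_rv1 indep_var_rv2)
  have C_int: "integrable M (\<lambda>\<omega>. C \<omega> $ i $ k)" "expectation (\<lambda>\<omega>. C \<omega> $ i $ k) = P $ i $ k" for i k
    using \<phi>_int[of i k] by (simp_all add: C P_def a_def)
  have entry[measurable]: "(\<lambda>A::real^'n^'n. A $ i $ k) \<in> borel_measurable borel" for i k
    by (intro borel_measurable_continuous_onI continuous_intros)
  have C'_int: "integrable M (\<lambda>\<omega>. C' \<omega> $ i $ k)" "expectation (\<lambda>\<omega>. C' \<omega> $ i $ k) = P $ i $ k" for i k
  proof -
    have "integrable (distr M borel C') (\<lambda>A. A $ i $ k)"
      unfolding C'_law using C_int(1) by (subst integrable_distr_eq) auto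
    then show "integrable M (\<lambda>\<omega>. C' \<omega> $ i $ k)"
      by (subst (asm) integrable_distr_eq) auto
    have "expectation (\<lambda>\<omega>. C' \<omega> $ i $ k) = integral\<^sup>L (distr M borel C') (\<lambda>A. A $ i $ k)"
      by (subst integral_distr) auto
    also have "\<dots> = P $ i $ k"
      unfolding C'_law by (subst integral_distr) (auto simp: C_int)
    finally show "expectation (\<lambda>\<omega>. C' \<omega> $ i $ k) = P $ i $ k" .
  qed
  have CC': "integrable M (\<lambda>\<omega>. C \<omega> $ i $ k * C' \<omega> $ l $ j)"
    "expectation (\<lambda>\<omega>. C \<omega> $ i $ k * C' \<omega> $ l $ j) = P $ i $ k * P $ l $ j" for i k l j
  proof -
    have "indep_var borel ((\<lambda>A. A $ i $ k) \<circ> C) borel ((\<lambda>A. A $ l $ j) \<circ> C')"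
      by (rule indep_var_compose[OF C'_indep entry entry])
    then have ind: "indep_var borel (\<lambda>\<omega>. C \<omega> $ i $ k) borel (\<lambda>\<omega>. C' \<omega> $ l $ j)"
      by (simp add: o_def)
    show "integrable M (\<lambda>\<omega>. C \<omega> $ i $ k * C' \<omega> $ l $ j)"
      by (rule indep_var_integrable[OF ind C_int(1) C'_int(1)])
    show "expectation (\<lambda>\<omega>. C \<omega> $ i $ k * C' \<omega> $ l $ j) = P $ i $ k * P $ l $ j"
      using indep_var_lebesgue_integral[OF ind C_int(1) C'_int(1)] by (simp add: C_int C'_int)
  qed
  \<comment> \<open>Each summand has one entry of \<open>C\<close> and one of \<open>C'\<close>, so
    independence applies term by term.\<close>
  have entry_eq: "(C \<omega> ** transpose (D \<omega>)) $ i $ j =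
      (\<Sum>k\<in>UNIV. \<Sum>l\<in>UNIV. S $ j $ l * (C \<omega> $ i $ k * C' \<omega> $ l $ k))" for \<omega> i j
    by (simp add: D S_def[symmetric] matrix_matrix_mult_def transpose_def sum_distrib_left mult_ac)
  have int_entry: "integrable M (\<lambda>\<omega>. (C \<omega> ** transpose (D \<omega>)) $ i $ j)" for i j
    unfolding entry_eq by (intro Bochner_Integration.integrable_sum integrable_mult_right CC')
  have E_entry: "expectation (\<lambda>\<omega>. (C \<omega> ** transpose (D \<omega>)) $ i $ j) = P $ i $ j" for i j
  proof -
    have "expectation (\<lambda>\<omega>. (C \<omega> ** transpose (D \<omega>)) $ i $ j) =
        (\<Sum>k\<in>UNIV. \<Sum>l\<in>UNIV. S $ j $ l * (P $ i $ k * P $ l $ k))"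
      unfolding entry_eq by (simp add: Bochner_Integration.integral_sum CC')
    \<comment> \<open>The inner sum over \<open>l\<close> is an entry of \<open>S ** P\<close>, the
      identity, so only \<open>k = j\<close> survives.\<close>
    also have "\<dots> = (\<Sum>k\<in>UNIV. P $ i $ k * (S ** P) $ j $ k)"
      by (simp add: matrix_matrix_mult_def sum_distrib_left mult_ac)
    also have "\<dots> = P $ i $ j"
      unfolding SP by (simp add: mat_def if_distrib cong: if_cong)
    finally show ?thesis .
  qed
  have "has_bochner_integral M (\<lambda>\<omega>. C \<omega> ** transpose (D \<omega>)) P"
    \<comment> \<open>The rule applies twice, first to the rows and then to their entries.\<close>
    by (intro has_bochner_integral_vec) (simp add: has_bochner_integral_iff int_entry E_entry)
  then show ?thesis
    using invertible P
    by (simp add: S_def laplacian_kernel_def has_bochner_integral_iff)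
qed

end
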